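(* Let $f:\mathbb{E}\to\mathbb{R}$ be a function and $\bar x\in\mathbb{E}$ a point such that the derivatives $f'(\bar x;u)$ and $f''_{BZ}(\bar x;u,z)$ exist for all directions $u\in\mathbb{E}$ and $z\in\mathbb{E}$. Suppose that \[ 0\in\partial^{(1)}_- f(\bar x),\qquad 0\in\partial^{(n)}_- f(\bar x;\underbrace{0,0,\dots,0}_{(n-1)\text{ times}})\quad\text{for all } n=2,3,4,\dots \] Then $f'(\bar x;u)\ge0$ for all $u\in\mathbb{E}$, and for every $u\in\mathbb{E}$, \[ f'(\bar x;u)=0\ \Longrightarrow\ f''_{BZ}(\bar x;u,z)\ge0\quad\text{for all } z\in\mathbb{E}. \]
   Context: $\mathbb{E}$ is a real finite-dimensional Euclidean space. $L^1(\mathbb{E})=L(\mathbb{E},\mathbb{R})$ is the space of continuous linear functionals, and $L^n(\mathbb{E})=L(\mathbb{E},L^{n-1}(\mathbb{E}))$ for $n>1$. For $f:\mathbb{E}\to\mathbb{R}$, $x,u\in\mathbb{E}$, the lower Hadamard directional derivative is \[ f^{(1)}_-(x;u)=\liminf_{t\downarrow 0,\,u'\to u} t^{-1}[f(x+tu')-f(x)] \] (here $t\to0$ through positive values and $\|u'-u\|\to 0$), and the lower Hadamard subdifferential is $\partial^{(1)}_- f(x)=\{x^*\in L^1(\mathbb{E})\mid x^*(u)\le f^{(1)}_-(x;u)\ \forall u\in\mathbb{E}\}$. Recursively, for an integer $n\ge2$, given $x_1^*\in\partial^{(1)}_- f(x)$ and $x_i^*\in\partial^{(i)}_- f(x;x_1^*,\dots,x_{i-1}^*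 )$ for $i=2,\dots,n-1$, the lower derivative of Hadamard type of order $n$ is the element of $[-\infty,+\infty]$ \[ f^{(n)}_-(x;x_1^*,\dots,x_{n-1}^*;u)=\liminf_{t\downarrow0,\,u'\to u} n!\,t^{-n}\Big[f(x+tu')-f(x)-\sum_{i=1}^{n-1}\frac{t^i}{i!}\,x_i^*\underbrace{(u')\dots(u')}_{i\text{ times}}\Big], \] and the lower subdifferential of Hadamard type of order $n$ is \[ \partial^{(n)}_- f(x;x_1^*,\dots,x_{n-1}^* )=\{x^*\in L^n(\mathbb{E})\mid x^*\underbrace{(u)\dots(u)}_{n\text{ times}}\le f^{(n)}_-(x;x_1^*,\dots,x_{n-1}^*;u)\ \forall u\in\mathbb{E}\}. \] The usual first-order directional derivative is $f'(x;u)=\lim_{t\downarrow0}t^{-1}[f(x+tu)-f(x)]$, and the second-order derivative of Ben-Tal and Zowe of $f$ at $x$ in directions $u,z\in\mathbb{E}$ is \[ f''_{BZ}(x;u,z)=\lim_{t\downarrow0}t^{-2}[f(x+tu+t^2z)-f(x)-tf'(x;u)]. \] *)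

theory Defs
  imports "HOL-Analysis.Analysis"
begin

text \<open>
  The spaces \<open>L\<^sup>n(E)\<close> depend on a natural number, so all of them are carved out of the one type
  of functions from lists of vectors to the reals: a functional \<open>\<phi>\<close> in \<open>L\<^sup>n(E)\<close> is represented
  by its iterated values, \<open>\<phi> [u\<^sub>1, \<dots>, u\<^sub>n]\<close> standing for \<open>\<phi>(u\<^sub>1)\<dots>(u\<^sub>n)\<close>, and by 0 on lists of any
  other length, which makes the representation unique. Its value at \<open>u\<close>, an element of
  \<open>L\<^sup>n\<^sup>-\<^sup>1(E)\<close>, is then \<open>\<lambda>us. \<phi> (u # us)\<close>. The recursion starts from \<open>L\<^sup>0(E)\<close>, the reals,
  so that \<open>L\<^sup>1(E) = L(E, \<real>)\<close>.
\<close>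

type_synonym 'a form = "'a list \<Rightarrow> real"

definition zero_form :: "'a form" where
  "zero_form = (\<lambda>_. 0)"

text \<open>The operator norm of \<open>L(E, L\<^sup>n\<^sup>-\<^sup>1(E))\<close>.\<close>

primrec form_norm :: "nat \<Rightarrow> ('a::real_normed_vector) form \<Rightarrow> real" where
  "form_norm 0 \<phi> = \<bar>\<phi> []\<bar>"
| "form_norm (Suc n) \<phi> = (SUP u\<in>cball 0 1. form_norm n (\<lambda>us. \<phi> (u # us)))"

primrec forms :: "nat \<Rightarrow> ('a::real_normed_vector) form set" where
  "forms 0 = {\<phi>. \<forall>us. us \<noteq> [] \<longrightarrow> \<phi> us = 0}"
| "forms (Suc n) = {\<phi>. \<phi> [] = 0 \<and>
     (\<forall>u. (\<lambda>us. \<phi> (u # us)) \<in> forms n) \<and>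
     (\<forall>u v us. \<phi> ((u + v) # us) = \<phi> (u # us) + \<phi> (v # us)) \<and>
     (\<forall>c u us. \<phi> ((c *\<^sub>R u) # us) = c * \<phi> (u # us)) \<and>
     (\<forall>u. ((\<lambda>v. form_norm n (\<lambda>us. \<phi> (v # us) - \<phi> (u # us))) \<longlongrightarrow> 0) (at u))}"

text \<open>
  In the next two definitions \<open>n \<ge> 1\<close> is the order and \<open>xs = [x\<^sub>1\<^sup>*, \<dots>, x\<^sub>n\<^sub>-\<^sub>1\<^sup>*]\<close>. For \<open>n = 1\<close> and
  \<open>xs = []\<close> the sum is empty and they are the first-order notions. They are total; they have their
  intended meaning when each \<open>x\<^sub>i\<^sup>*\<close> lies in the subdifferential of order \<open>i\<close> at \<open>x\<close> for
  \<open>x\<^sub>1\<^sup>*, \<dots>, x\<^sub>i\<^sub>-\<^sub>1\<^sup>*\<close>. The value \<open>u' = u\<close> is admitted in the lower limit.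
\<close>

definition lower_hadamard_deriv ::
  "nat \<Rightarrow> ('a::real_normed_vector \<Rightarrow> real) \<Rightarrow> 'a \<Rightarrow> 'a form list \<Rightarrow> 'a \<Rightarrow> ereal" where
  "lower_hadamard_deriv n f x xs u =
     Liminf (at_right 0 \<times>\<^sub>F nhds u)
       (\<lambda>(t, u'). ereal (fact n / t ^ n *
          (f (x + t *\<^sub>R u') - f x -
            (\<Sum>i = 1..n - 1. t ^ i / fact i * (xs ! (i - 1)) (replicate i u')))))"

definition lower_hadamard_subdiff ::
  "nat \<Rightarrow> ('a::real_normed_vector \<Rightarrow> real) \<Rightarrow> 'a \<Rightarrow> 'a form list \<Rightarrow> 'a form set" where
  "lower_hadamard_subdiff n f x xs =
     {\<phi> \<in> forms n. \<forall>u. ereal (\<phi> (replicate n u)) \<le> lower_hadamard_deriv n f x xs u}"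

text \<open>
  The limits below are taken in \<open>[-\<infinity>, +\<infinity>]\<close>. A finite derivative is in particular a derivative in
  this sense, with the same value (see the lemmas at the end).
\<close>

definition dir_quotient ::
  "('a::real_normed_vector \<Rightarrow> real) \<Rightarrow> 'a \<Rightarrow> 'a \<Rightarrow> real \<Rightarrow> ereal" where
  "dir_quotient f x u t = ereal ((f (x + t *\<^sub>R u) - f x) / t)"

definition dir_deriv_exists ::
  "('a::real_normed_vector \<Rightarrow> real) \<Rightarrow> 'a \<Rightarrow> 'a \<Rightarrow> bool" where
  "dir_deriv_exists f x u \<longleftrightarrow> (\<exists>l. (dir_quotient f x u \<longlongrightarrow> l) (at_right 0))"

definition dir_deriv ::
  "('a::real_normed_vector \<Rightarrow> real) \<Rightarrow> 'a \<Rightarrow> 'a \<Rightarrow> ereal" where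
  "dir_deriv f x u = Lim (at_right 0) (dir_quotient f x u)"

definition bz_quotient ::
  "('a::real_normed_vector \<Rightarrow> real) \<Rightarrow> 'a \<Rightarrow> 'a \<Rightarrow> 'a \<Rightarrow> real \<Rightarrow> ereal" where
  "bz_quotient f x u z t =
     (ereal (f (x + t *\<^sub>R u + t\<^sup>2 *\<^sub>R z) - f x) - ereal t * dir_deriv f x u) / ereal (t\<^sup>2)"

definition bz_deriv_exists ::
  "('a::real_normed_vector \<Rightarrow> real) \<Rightarrow> 'a \<Rightarrow> 'a \<Rightarrow> 'a \<Rightarrow> bool" where
  "bz_deriv_exists f x u z \<longleftrightarrow> (\<exists>l. (bz_quotient f x u z \<longlongrightarrow> l) (at_right 0))"

definition bz_deriv ::
  "('a::real_normed_vector \<Rightarrow> real) \<Rightarrow> 'a \<Rightarrow> 'a \<Rightarrow> 'a \<Rightarrow> ereal" where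
  "bz_deriv f x u z = Lim (at_right 0) (bz_quotient f x u z)"

lemma dir_deriv_finite:
  fixes l :: real
  assumes "((\<lambda>t. (f (x + t *\<^sub>R u) - f x) / t) \<longlongrightarrow> l) (at_right 0)"
  shows "dir_deriv_exists f x u" and "dir_deriv f x u = ereal l"
proof -
  have lim: "(dir_quotient f x u \<longlongrightarrow> ereal l) (at_right 0)"
    unfolding dir_quotient_def using assms by (intro tendsto_intros)
  then show "dir_deriv_exists f x u"
    unfolding dir_deriv_exists_def by blast
  show "dir_deriv f x u = ereal l"
    unfolding dir_deriv_def using lim by (intro tendsto_Lim) simp_all
qed

lemma bz_deriv_finite:
  fixes l m :: real
  assumes "((\<lambda>t. (f (x + t *\<^sub>R u) - f x) / t) \<longlongrightarrow> l) (at_right 0)"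
    and "((\<lambda>t. (f (x + t *\<^sub>R u + t\<^sup>2 *\<^sub>R z) - f x - t * l) / t\<^sup>2) \<longlongrightarrow> m) (at_right 0)"
  shows "bz_deriv_exists f x u z" and "bz_deriv f x u z = ereal m"
proof -
  have "((\<lambda>t. ereal ((f (x + t *\<^sub>R u + t\<^sup>2 *\<^sub>R z) - f x - t * l) / t\<^sup>2)) \<longlongrightarrow> ereal m) (at_right 0)"
    using assms(2) by (intro tendsto_intros)
  moreover have "\<forall>\<^sub>F t in at_right 0.
      ereal ((f (x + t *\<^sub>R u + t\<^sup>2 *\<^sub>R z) - f x - t * l) / t\<^sup>2) = bz_quotient f x u z t"
    using eventually_at_right_less[of 0]
    by eventually_elim (simp add: bz_quotient_def dir_deriv_finite(2)[OF assms(1)])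
  ultimately have lim: "(bz_quotient f x u z \<longlongrightarrow> ereal m) (at_right 0)"
    by (rule Lim_transform_eventually)
  then show "bz_deriv_exists f x u z"
    unfolding bz_deriv_exists_def by blast
  show "bz_deriv f x u z = ereal m"
    unfolding bz_deriv_def using lim by (intro tendsto_Lim) simp_all
qed

end

theory Submission
  imports Defs
begin

text \<open>
  The lower Hadamard derivative of order \<open>n\<close> is a lower limit over all approaches \<open>u' \<rightarrow> u\<close>, so it
  is a lower bound for the limit along any curve \<open>t \<mapsto> w t\<close> with \<open>w t \<rightarrow> u\<close>. When all the
  functionals are zero, the quotient is \<open>n! (f (x + t w t) - f x) / t\<^sup>n\<close>, and membership of zero in
  the subdifferential makes every such limit nonnegative
  (\<open>limit_along_curve_nonneg\<close>). The two classical derivatives are limits of this kind: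
  \<open>f'(x; u)\<close> comes from \<open>n = 1\<close> and the constant curve \<open>w t = u\<close>, and, if \<open>f'(x; u) = 0\<close>, the
  derivative of Ben-Tal and Zowe comes from \<open>n = 2\<close> and \<open>w t = u + t z\<close>, because
  \<open>x + t u + t\<^sup>2 z = x + t (u + t z)\<close>.
\<close>

lemma lower_hadamard_deriv_zero_forms:
  "lower_hadamard_deriv n f x (replicate (n - 1) zero_form) u =
     Liminf (at_right 0 \<times>\<^sub>F nhds u)
       (\<lambda>(t, u'). ereal (fact n * ((f (x + t *\<^sub>R u') - f x) / t ^ n)))"
proof -
  have "(\<Sum>i = 1..n - 1. t ^ i / fact i *
      (replicate (n - 1) zero_form ! (i - 1)) (replicate i v)) = 0" for t and v :: 'a
    by (intro sum.neutral) (auto simp: zero_form_def)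
  then show ?thesis
    unfolding lower_hadamard_deriv_def by simp
qed

text \<open>
  The graph \<open>t \<mapsto> (t, w t)\<close> of the curve tends to the product filter over which the lower limit is
  taken, and a lower limit can only grow when it is restricted to such a curve.
\<close>

lemma limit_along_curve_nonneg:
  fixes f :: "'a::real_normed_vector \<Rightarrow> real"
  assumes zero: "zero_form \<in> lower_hadamard_subdiff n f x (replicate (n - 1) zero_form)"
    and w: "(w \<longlongrightarrow> u) (at_right 0)"
    and lim: "((\<lambda>t. ereal ((f (x + t *\<^sub>R w t) - f x) / t ^ n)) \<longlongrightarrow> l) (at_right 0)"
  shows "0 \<le> l"
proof -
  let ?q = "\<lambda>(t, u'). ereal (fact n * ((f (x + t *\<^sub>R u') - f x) / t ^ n))"
  have "filterlim (\<lambda>t. (t, w t)) (at_right 0 \<times>\<^sub>F nhds u) (at_right 0)"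
    using w by (intro filterlim_Pair filterlim_ident)
  then have graph: "filtermap (\<lambda>t. (t, w t)) (at_right 0) \<le> at_right 0 \<times>\<^sub>F nhds u"
    by (simp add: filterlim_def)
  have "0 \<le> Liminf (at_right 0 \<times>\<^sub>F nhds u) ?q"
    using zero unfolding lower_hadamard_subdiff_def lower_hadamard_deriv_zero_forms
    by (simp add: zero_form_def zero_ereal_def)
  also have "\<dots> \<le> Liminf (filtermap (\<lambda>t. (t, w t)) (at_right 0)) ?q"
    using graph unfolding Liminf_def le_filter_def by (intro SUP_subset_mono) auto
  also have "\<dots> \<le> Liminf (at_right 0) (\<lambda>t. ?q (t, w t))"
    by (rule Liminf_filtermap_le)
  also have "\<dots> = ereal (fact n) * l"
    using tendsto_cmult_ereal[OF _ lim, of "ereal (fact n)"]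
    by (intro lim_imp_Liminf) simp_all
  finally show ?thesis
    using fact_gt_zero[of n, where 'a = real] by (auto simp: ereal_zero_le_0_iff)
qed

lemma dir_deriv_nonneg:
  assumes "dir_deriv_exists f x u"
    and "zero_form \<in> lower_hadamard_subdiff 1 f x []"
  shows "0 \<le> dir_deriv f x u"
proof -
  obtain l where l: "(dir_quotient f x u \<longlongrightarrow> l) (at_right 0)"
    using assms(1) by (auto simp: dir_deriv_exists_def)
  then have "0 \<le> l"
    using limit_along_curve_nonneg[of 1 f x "\<lambda>_. u" u l] assms(2)
    by (simp add: dir_quotient_def[abs_def])
  moreover have "dir_deriv f x u = l"
    unfolding dir_deriv_def using l by (intro tendsto_Lim) simp_all
  ultimately show ?thesis
    by simp
qed

lemma bz_deriv_nonneg: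
  assumes "bz_deriv_exists f x u z"
    and "zero_form \<in> lower_hadamard_subdiff 2 f x [zero_form]"
    and stationary: "dir_deriv f x u = 0"
  shows "0 \<le> bz_deriv f x u z"
proof -
  obtain l where l: "(bz_quotient f x u z \<longlongrightarrow> l) (at_right 0)"
    using assms(1) by (auto simp: bz_deriv_exists_def)
  have "((\<lambda>t. u + t *\<^sub>R z) \<longlongrightarrow> u + 0 *\<^sub>R z) (at_right 0)"
    by (intro tendsto_intros)
  then have curve: "((\<lambda>t. u + t *\<^sub>R z) \<longlongrightarrow> u) (at_right 0)"
    by simp
  have "\<forall>\<^sub>F t in at_right 0.
      bz_quotient f x u z t = ereal ((f (x + t *\<^sub>R (u + t *\<^sub>R z)) - f x) / t\<^sup>2)"
    using eventually_at_right_less[of 0]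
    by eventually_elim
      (simp add: bz_quotient_def stationary scaleR_add_right power2_eq_square add.assoc)
  with l have "((\<lambda>t. ereal ((f (x + t *\<^sub>R (u + t *\<^sub>R z)) - f x) / t\<^sup>2)) \<longlongrightarrow> l) (at_right 0)"
    by (rule Lim_transform_eventually)
  then have "0 \<le> l"
    using limit_along_curve_nonneg[of 2 f x, OF _ curve] assms(2) by simp
  moreover have "bz_deriv f x u z = l"
    unfolding bz_deriv_def using l by (intro tendsto_Lim) simp_all
  ultimately show ?thesis
    by simp
qed

theorem proposition8p7:
  fixes f :: "'a::euclidean_space \<Rightarrow> real" and x :: 'a
  assumes "\<And>u. dir_deriv_exists f x u"
    and "\<And>u z. bz_deriv_exists f x u z"
    and "zero_form \<in> lower_hadamard_subdiff 1 f x []"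
    and "\<And>n. n \<ge> 2 \<Longrightarrow> zero_form \<in> lower_hadamard_subdiff n f x (replicate (n - 1) zero_form)"
  shows "(\<forall>u. dir_deriv f x u \<ge> 0) \<and>
    (\<forall>u. dir_deriv f x u = 0 \<longrightarrow> (\<forall>z. bz_deriv f x u z \<ge> 0))"
proof -
  have "zero_form \<in> lower_hadamard_subdiff 2 f x [zero_form]"
    using assms(4)[of 2] by simp
  then show ?thesis
    using assms(1-3) by (blast intro: dir_deriv_nonneg bz_deriv_nonneg)
qed

end
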